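(* Let $\mathcal{G}$ be an undirected graph with $n$ vertices and let $(\mathcal{G},p)$ and $(\mathcal{G},q)$ be two frameworks in $\mathbb{R}^d$. If $\mathcal{G}$ is connected, then $D(p)=D(q)$ if and only if $\mathbf{E}(p)=\mathbf{E}(q)$.
   Context: $\mathcal{G}=(\mathcal{V},\mathcal{E})$ is finite, simple and undirected with $\mathcal{V}=\{1,\dots,n\}$ and $m=|\mathcal{E}|$. A framework $(\mathcal{G},p)$ in $\mathbb{R}^d$ is a graph with a configuration $p=(p_1^T,\dots,p_n^T)^T\in\mathbb{R}^{nd}$, $p_i\in\mathbb{R}^d$; $e_{ij}=p_i-p_j$. $D(p)\in\mathbb{R}^{n\times n}$ is the Euclidean distance matrix, with $(i,j)$ entry $\|p_i-p_j\|^2$. Fix an orientation and an ordering of the edges of $\mathcal{G}$ (the same for $p$ and $q$). $E(p)=(\dots,e_{ij},\dots)\in\mathbb{R}^{d\times m}$ is the matrix whose columns are the relative position vectors $e_{ij}$, one for each edge $(i,j)\in\mathcal{E}$, and $\mathbf{E}(p)=E(p)^TE(p)\in\mathbb{R}^{m\times m}$ is its Gram matrix. *)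

theory Defs
  imports
    Complex_Main
    "Jordan_Normal_Form.Matrix"
    "Graph_Theory.Digraph_Component"
begin

text \<open>
  A finite simple undirected graph is a \<^locale>\<open>pair_graph\<close>: a finite, loop-free digraph whose set of
  ordered pairs is symmetric. An undirected edge \<open>{u, v}\<close> corresponds to the two arcs
  \<open>(u, v)\<close> and \<open>(v, u)\<close>.

  Vertices are numbered from \<open>1\<close>, whereas indices of vectors and matrices start at \<open>0\<close>.
\<close>

definition simple_graph :: "nat \<Rightarrow> nat pair_pre_digraph \<Rightarrow> bool" where
  "simple_graph n G \<longleftrightarrow> pair_graph G \<and> pverts G = {1..n}"

definition framework :: "nat \<Rightarrow> nat \<Rightarrow> nat pair_pre_digraph \<Rightarrow> real vec \<Rightarrow> bool" where
  "framework d n G p \<longleftrightarrow> simple_graph n G \<and> p \<in> carrier_vec (n * d)"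

text \<open>
  An orientation and an ordering of the edges together are a list of arcs containing exactly one
  of the two arcs of every undirected edge, exactly once; its length is the number of edges.
\<close>

definition oriented_edge_list :: "nat pair_pre_digraph \<Rightarrow> (nat \<times> nat) list \<Rightarrow> bool" where
  "oriented_edge_list G es \<longleftrightarrow>
     distinct es \<and> set es \<subseteq> parcs G \<and>
     (\<forall>(u, v) \<in> parcs G. (u, v) \<in> set es \<longleftrightarrow> (v, u) \<notin> set es)"

text \<open>The block \<open>p\<^sub>i\<close> of the stacked configuration vector \<open>p\<close>, for \<open>i \<ge> 1\<close>.\<close>

definition point :: "nat \<Rightarrow> real vec \<Rightarrow> nat \<Rightarrow> real vec" where
  "point d p i = vec d (\<lambda>k. p $ ((i - 1) * d + k))"

definition rel_position :: "nat \<Rightarrow> real vec \<Rightarrow> nat \<Rightarrow> nat \<Rightarrow> real vec" where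
  "rel_position d p i j = point d p i - point d p j"

definition euclidean_norm :: "real vec \<Rightarrow> real" where
  "euclidean_norm v = sqrt (v \<bullet> v)"

definition distance_matrix :: "nat \<Rightarrow> nat \<Rightarrow> real vec \<Rightarrow> real mat" where
  "distance_matrix d n p =
     mat n n (\<lambda>(i, j). (euclidean_norm (point d p (Suc i) - point d p (Suc j)))\<^sup>2)"

definition edge_matrix :: "nat \<Rightarrow> (nat \<times> nat) list \<Rightarrow> real vec \<Rightarrow> real mat" where
  "edge_matrix d es p = mat_of_cols d (map (\<lambda>(i, j). rel_position d p i j) es)"

definition edge_gram_matrix :: "nat \<Rightarrow> (nat \<times> nat) list \<Rightarrow> real vec \<Rightarrow> real mat" where
  "edge_gram_matrix d es p = transpose_mat (edge_matrix d es p) * edge_matrix d es p"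

end

(* By polarization, the inner product of two relative position vectors is a combination of squared
   distances: 2 <p_i - p_j, p_k - p_l> = |p_i - p_l|^2 + |p_j - p_k|^2 - |p_i - p_k|^2 - |p_j - p_l|^2,
   so D(p) determines E(p)^T E(p). Conversely, the inner product <p_u - p_v, p_x - p_y> is additive
   under concatenation of paths in each of the pairs (u, v) and (x, y). In a connected graph its
   values on all pairs of vertices are therefore determined by those on pairs of edges, and
   (x, y) = (u, v) gives D(p). *)
theory Submission
  imports Defs
begin

text \<open>Arguments are vertex pairs, adjacent or not: listed edges give the Gram entries, equal
  pairs \<open>(u, v)\<close>, \<open>(u, v)\<close> the squared distances.\<close>

definition rel_inner :: "nat \<Rightarrow> real vec \<Rightarrow> nat \<times> nat \<Rightarrow> nat \<times> nat \<Rightarrow> real" where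
  "rel_inner d p e f = rel_position d p (fst e) (snd e) \<bullet> rel_position d p (fst f) (snd f)"

lemma rel_position_carrier [simp]: "rel_position d p i j \<in> carrier_vec d"
  by (simp add: rel_position_def point_def)

lemma rel_inner_conv_sum:
  "rel_inner d p (u, v) (x, y) =
     (\<Sum>k<d. (point d p u $ k - point d p v $ k) * (point d p x $ k - point d p y $ k))"
  by (auto simp: rel_inner_def rel_position_def scalar_prod_def point_def atLeast0LessThan
      intro!: sum.cong)

lemma rel_inner_commute: "rel_inner d p e f = rel_inner d p f e"
  unfolding rel_inner_def by (rule comm_scalar_prod[of _ d]) simp_all

lemma rel_inner_refl: "rel_inner d p (u, u) f = 0"
  by (cases f) (simp add: rel_inner_conv_sum)

text \<open>Additivity in the first pair: the relative positions telescope through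
  \<open>v\<close>.\<close>

lemma rel_inner_chain: "rel_inner d p (u, w) f = rel_inner d p (u, v) f + rel_inner d p (v, w) f"
  by (cases f) (simp add: rel_inner_conv_sum flip: sum.distrib, simp add: algebra_simps)

lemma rel_inner_swap: "rel_inner d p (v, u) f = - rel_inner d p (u, v) f"
  using rel_inner_chain[of d p u u f v] by (simp add: rel_inner_refl)

lemma rel_inner_polarization:
  "2 * rel_inner d p (i, j) (k, l) =
     rel_inner d p (i, l) (i, l) + rel_inner d p (j, k) (j, k)
     - rel_inner d p (i, k) (i, k) - rel_inner d p (j, l) (j, l)"
  unfolding rel_inner_conv_sum sum_distrib_left sum.distrib [symmetric] sum_subtractf [symmetric]
  by (rule sum.cong) (simp_all add: algebra_simps)

lemma distance_matrix_eq_iff: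
  "distance_matrix d n p = distance_matrix d n q \<longleftrightarrow>
     (\<forall>u\<in>{1..n}. \<forall>v\<in>{1..n}. rel_inner d p (u, v) (u, v) = rel_inner d q (u, v) (u, v))"
proof -
  have norm: "(euclidean_norm (point d r u - point d r v))\<^sup>2 = rel_inner d r (u, v) (u, v)" for r u v
    by (simp add: euclidean_norm_def rel_inner_def rel_position_def scalar_prod_def sum_nonneg)
  have "distance_matrix d n p = distance_matrix d n q \<longleftrightarrow>
      (\<forall>i<n. \<forall>j<n. rel_inner d p (Suc i, Suc j) (Suc i, Suc j) =
                    rel_inner d q (Suc i, Suc j) (Suc i, Suc j))"
    by (auto simp: distance_matrix_def norm mat_eq_iff)
  \<comment> \<open>Matrix indices start at 0 and vertices at 1, so \<open>Suc\<close> carries the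
    former to the latter.\<close>
  also have "\<dots> \<longleftrightarrow> (\<forall>u\<in>Suc ` {..<n}. \<forall>v\<in>Suc ` {..<n}.
      rel_inner d p (u, v) (u, v) = rel_inner d q (u, v) (u, v))"
    by auto
  finally show ?thesis
    by (simp only: image_Suc_lessThan)
qed

lemma edge_gram_matrix_eq_iff:
  "edge_gram_matrix d es p = edge_gram_matrix d es q \<longleftrightarrow>
     (\<forall>e\<in>set es. \<forall>f\<in>set es. rel_inner d p e f = rel_inner d q e f)"
proof -
  have gram: "edge_gram_matrix d es r =
      mat (length es) (length es) (\<lambda>(a, b). rel_inner d r (es ! a) (es ! b))" for r
    by (rule eq_matI)
      (simp_all add: edge_gram_matrix_def edge_matrix_def rel_inner_def case_prod_beta)
  show ?thesis
    unfolding gram by (auto simp: mat_eq_iff all_set_conv_all_nth)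
qed

text \<open>With \<open>f\<close> fixed, agreement on \<open>A\<close> spreads along walks by
  additivity. The converse of \<open>A\<close> is allowed because an edge list holds only one
  orientation of each edge.\<close>

lemma rel_inner_eq_sym_rtrancl:
  assumes "\<And>e. e \<in> A \<Longrightarrow> rel_inner d p e f = rel_inner d q e f"
    and "(u, v) \<in> (A \<union> A\<inverse>)\<^sup>*"
  shows "rel_inner d p (u, v) f = rel_inner d q (u, v) f"
  using assms(2)
proof induction
  case base
  show ?case by (simp add: rel_inner_refl)
next
  case (step v w)
  \<comment> \<open>An arc traversed backwards changes the sign on both sides alike.\<close>
  have "rel_inner d p (v, w) f = rel_inner d q (v, w) f"
    using step.hyps(2) assms(1)[of "(v, w)"] assms(1)[of "(w, v)"] rel_inner_swap[of d _ v w f]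
    by auto
  with step.IH show ?case
    by (simp add: rel_inner_chain[of d _ u w f v])
qed

text \<open>The walk argument is applied once in each argument, with symmetry of the inner product
  in between.\<close>

lemma rel_inner_eq_if_generating:
  assumes eq: "\<And>e f. \<lbrakk>e \<in> A; f \<in> A\<rbrakk> \<Longrightarrow> rel_inner d p e f = rel_inner d q e f"
    and uv: "(u, v) \<in> (A \<union> A\<inverse>)\<^sup>*" and xy: "(x, y) \<in> (A \<union> A\<inverse>)\<^sup>*"
  shows "rel_inner d p (u, v) (x, y) = rel_inner d q (u, v) (x, y)"
proof (rule rel_inner_eq_sym_rtrancl[OF _ uv])
  fix e
  assume "e \<in> A"
  then have "rel_inner d p (x, y) e = rel_inner d q (x, y) e"
    using eq by (intro rel_inner_eq_sym_rtrancl[OF _ xy]) auto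
  then show "rel_inner d p e (x, y) = rel_inner d q e (x, y)"
    by (metis rel_inner_commute)
qed

text \<open>\<open>connected\<close> ignores arc directions; since the arc set is symmetric, a
  directed walk exists as well.\<close>

lemma simple_graph_connected_rtrancl:
  assumes "simple_graph n G" and "Digraph_Component.connected (with_proj G)"
    and "u \<in> {1..n}" and "v \<in> {1..n}"
  shows "(u, v) \<in> (parcs G)\<^sup>*"
proof -
  interpret pair_graph G
    using assms(1) by (simp add: simple_graph_def)
  have "strongly_connected (with_proj G)"
    using symmetric_connected_imp_strongly_connected assms(2) by blast
  then have "u \<rightarrow>\<^sup>*\<^bsub>with_proj G\<^esub> v"
    using assms by (auto simp: simple_graph_def)
  then show ?thesis
    using reachable_rtranclI by force
qed

theorem theorem3p13:
  fixes n d :: nat and G :: "nat pair_pre_digraph" and p q :: "real vec"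
    and es :: "(nat \<times> nat) list"
  assumes "framework d n G p" and "framework d n G q"
    and "oriented_edge_list G es"
    and "Digraph_Component.connected (with_proj G)"
  shows "distance_matrix d n p = distance_matrix d n q \<longleftrightarrow>
         edge_gram_matrix d es p = edge_gram_matrix d es q"
proof -
  have graph: "simple_graph n G"
    using assms(1) by (simp add: framework_def)
  then interpret pair_graph G
    by (simp add: simple_graph_def)
  have arcs: "set es \<subseteq> parcs G" "parcs G \<subseteq> set es \<union> (set es)\<inverse>"
    using assms(3) by (auto simp: oriented_edge_list_def)
  have verts: "u \<in> {1..n}" "v \<in> {1..n}" if "(u, v) \<in> set es" for u v
    using that arcs(1) graph arc_fst_in_verts[of "(u, v)"] arc_snd_in_verts[of "(u, v)"]
    by (auto simp: simple_graph_def)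
  show ?thesis
    unfolding distance_matrix_eq_iff edge_gram_matrix_eq_iff
  proof (intro iffI ballI)
    fix e f
    assume dist: "\<forall>u\<in>{1..n}. \<forall>v\<in>{1..n}. rel_inner d p (u, v) (u, v) = rel_inner d q (u, v) (u, v)"
      and mem: "e \<in> set es" "f \<in> set es"
    obtain i j k l where ef: "e = (i, j)" "f = (k, l)"
      by (metis surj_pair)
    \<comment> \<open>The pairs \<open>(i, l)\<close>, \<open>(j, k)\<close>, \<open>(i, k)\<close>,
      \<open>(j, l)\<close> need not be edges, but all four are vertex pairs covered by
      \<open>dist\<close>.\<close>
    have "2 * rel_inner d p e f = 2 * rel_inner d q e f"
      unfolding ef rel_inner_polarization using dist verts mem ef by metis
    then show "rel_inner d p e f = rel_inner d q e f"
      by simp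
  next
    fix u v
    assume gram: "\<forall>e\<in>set es. \<forall>f\<in>set es. rel_inner d p e f = rel_inner d q e f"
      and uv: "u \<in> {1..n}" "v \<in> {1..n}"
    \<comment> \<open>Only this direction uses connectedness: a walk in the graph becomes one along
      listed edges and their reversals.\<close>
    have "(u, v) \<in> (set es \<union> (set es)\<inverse>)\<^sup>*"
      using simple_graph_connected_rtrancl[OF graph assms(4) uv] rtrancl_mono[OF arcs(2)] by blast
    then show "rel_inner d p (u, v) (u, v) = rel_inner d q (u, v) (u, v)"
      using rel_inner_eq_if_generating[of "set es"] gram by blast
  qed
qed

end
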